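(* Consider the robust optimal control problem $$\min_{u\in\mathcal U}\ \max_{(x,w)\in\mathcal V(u)} J(u,x,w)\quad\text{s.t.}\quad g^{\mathrm c}(u,x,w)\le0\ \ \forall(x,w)\in\mathcal V(u),\qquad(\mathrm R)$$ with $\mathcal V(u)=\{(x,w)\in\mathcal X\times\bar{\mathcal W}:\phi(u,x,w)=0,\ h^{\mathrm c}(u,x,w)\ge0,\ r^{\mathrm c}(u,x,w)=0\}$. Any problem (R) satisfying the control assumptions (A)–(D) of the context can be written as a generalized semi-infinite program (GSIP) with $\rho$-times differentiable objective and constraints. It can then be solved to optimality by the Algorithm of the context under the convergence assumptions (T) of the context and, for equivalence with (R), the density qualification (Q) of the context.
   Context: Notation: $[n]=\{1,\dots,n\}$; vector inequalities are componentwise; $\Lambda_{n_h+1}=\{\lambda\in\mathbb R^{n_h+1}:\sum_{j=1}^{n_h+1}\lambda_j=1,\ \lambda_j\ge0\}$. $\mathcal C^\rho$ means $\rho$-times differentiable for $\rho\ge1$ and continuous for $\rho=0$; "$\rho$-times differentiable" is meant in this sense. Control data: state trajectories $x=(x_0,\dots,x_N)\in\mathcal X\subseteq\mathbb R^{n_x}$, control trajectories $u=(u_0,\dots,u_{N-1})\in\mathcal U\subseteq\mathbb R^{n_u}$, disturbance trajectories $w=(w_0,\dots,w_{N-1})\in\bar{\mathcal W}\subset\mathbb R^{n_w}$, with $\bar{\mathcal W}$ a compact superset of the admissible disturbances. On $\mathcal U\times\mathcal X\times\bar{\mathcal W}$ are given: $\phi$ with values in $\mathbb R^{n_x}$ (stacking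 the per-step discrete-time dynamics $\phi_k(x_{k+1},x_k,u_k,w_k)=0$ with the initial condition), $h^{\mathrm c}$ with values in $\mathbb R^{n_{h^{\mathrm c}}}$, $r^{\mathrm c}$ with values in $\mathbb R^{n_{r^{\mathrm c}}}$, $g^{\mathrm c}$ with values in $\mathbb R^{n_{g^{\mathrm c}}}$, and the cost $J$ with values in $\mathbb R$. Control assumptions: (A) $\mathcal X$, $\mathcal U$ and $\Gamma\subset\mathbb R$ are non-empty and compact, and $\mathcal V(u)$ is non-empty and compact for every $u\in\mathcal U$. (B) The uncertainty admits a partition $v=(x,p^{\mathrm c},q^{\mathrm c})$, $w=(p^{\mathrm c},q^{\mathrm c})$, with $q^{\mathrm c}\in\bar{\mathcal Q}^{\mathrm c}\subset\mathbb R^{n_w-n_{r^{\mathrm c}}}$, $\bar{\mathcal Q}^{\mathrm c}$ compact, and $\{q^{\mathrm c}:\exists(x,p^{\mathrm c}),\ (x,p^{\mathrm c},q^{\mathrm c})\in\mathcal V(u)\}\subseteq\bar{\mathcal Q}^{\mathrm c}$ for all $u\in\mathcal U$, such that for every $u\in\mathcal U$ and $q^{\mathrm c}\in\bar{\mathcal Q}^{\mathrm c}$ the equations $\phi(u,x,w)=0$, $r^{\mathrm c}(u,x,w)=0$ admit a unique solution $(x,p^{\mathrm c})$, continuous in $(u,q^{\mathrm c})$; and $\mathcal X$ and $\bar{\mathcal W}$ are large enough that every $v=(x,p^{\mathrm c},q^{\mathrm c})$ with $(x,p^{\mathrm c})$ that solution and $q^{\mathrm c}\in\bar{\mathcal Q}^{\mathrm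 c}$ (including those where $h^{\mathrm c}\not\ge0$) lies in $\operatorname{int}(\mathcal X\times\bar{\mathcal W})$, so that $\phi,r^{\mathrm c},h^{\mathrm c},g^{\mathrm c},J$ are defined on a neighborhood of every point the algorithm evaluates. (C) $J,g^{\mathrm c},h^{\mathrm c},r^{\mathrm c},\phi\in\mathcal C^\rho$, $\rho\in\{0,\dots,+\infty\}$. (D) For every $u\in\mathcal U$, $\max_{(x,w)\in\mathcal V(u)}J(u,x,w)\in\Gamma$. Generalized semi-infinite program (GSIP): a problem $\min_{z\in\mathcal Z}f(z)$ s.t. $g(z,v)\le0$ for all $v\in\mathcal V(z)=\{v\in\bar{\mathcal V}:h(z,v)\ge0,\ r(z,v)=0\}$, where $\mathcal Z\subseteq\mathbb R^{n_z}$, $\bar{\mathcal V}\subset\mathbb R^{n_v}$ is bounded, $f:\mathcal Z\to\mathbb R$, and $g,h,r$ map $\mathcal Z\times\bar{\mathcal V}$ to $\mathbb R^{n_g},\mathbb R^{n_h},\mathbb R^{n_r}$. GSIP assumptions: (a) $\mathcal Z$ and $\mathcal V(z)$ are non-empty, compact, and uniformly bounded for all $z\in\mathcal Z$. (b) There is a partition $v=(p,q)$ with $p\in\mathbb R^{n_r}$, $q\in\bar{\mathcal Q}\subset\mathbb R^{n_v-n_r}$, $\bar{\mathcal Q}$ compact, such that for every $z\in\mathcal Z$: (i) for each $q\in\bar{\mathcal Q}$, $r(z,(p,q))=0$ has a unique solution $p$, continuous in $(z,q)$; (ii) $\{q:\exists p,\ (p,q)\in\mathcal V(z)\}\subseteq\bar{\mathcal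 Q}$; (iii) every $(p,q)$ with $r(z,(p,q))=0$ and $q\in\bar{\mathcal Q}$ (including those where $h\not\ge0$) lies in $\operatorname{int}(\bar{\mathcal V})$, so that $g,h,r$ are defined on a neighborhood of every point the algorithm evaluates. (c) $f,g,h,r\in\mathcal C^\rho$, $\rho\in\{0,\dots,+\infty\}$. Existence-constrained program (E) associated with a GSIP: $$\min_{z\in\mathcal Z} f(z)\ \text{ s.t. }\ \forall q\in\bar{\mathcal Q},\ v=(p,q)\text{ with } r(z,(p,q))=0,\ \forall i\in[n_g],\ \exists\lambda_i\in\Lambda_{n_h+1}:\ \lambda_{i,1}g_i(z,v)+\sum_{j=1}^{n_h}\lambda_{i,j+1}h_j(z,v)\le0.$$ Master subproblem $(\mathrm M_{\mathbb Q})$ for finite $\mathbb Q=\{q_1,\dots,q_M\}\subseteq\bar{\mathcal Q}$: minimize $f(z)$ over $z\in\mathcal Z$, $\{p_m\}_{m\in[M]}$, $\{\lambda_{i,m}\}_{i\in[n_g],m\in[M]}$ subject to, for all $m,i$: $v_m=(p_m,q_m)$, $\lambda_{i,m}\in\Lambda_{n_h+1}$, $r(z,v_m)=0$, $\lambda_{i,m,1}g_i(z,v_m)+\sum_{j=1}^{n_h}\lambda_{i,m,j+1}h_j(z,v_m)\le0$. Separation subproblem $(\mathrm S_i(z))$: maximize $s$ over $q\in\bar{\mathcal Q}$, $p$, $s\in\mathbb R$ subject to $v=(p,q)$, $r(z,v)=0$, $s\le g_i(z,v)$, $s\le h_j(z,v)$ for all $j\in[n_h]$. A solution is denoted $(q_i^*,p_i^*,s_i^*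 )$. Algorithm: input a nonempty finite $\mathbb Q_0\subseteq\bar{\mathcal Q}$; set $\mathbb Q\leftarrow\mathbb Q_0$, $m\leftarrow\mathrm{card}(\mathbb Q_0)$. Repeat: (1) solve $(\mathrm M_{\mathbb Q})$ for a minimizer with $z$-component $z_m^*$; (2) $m\leftarrow m+1$; (3) for each $i\in[n_g]$ solve $(\mathrm S_i(z_{m-1}^* ))$; (4) select $i^*\in\arg\max_i s_i^*$ and set $(q_m,s_m)\leftarrow(q_{i^*}^*,s_{i^*}^* )$; (5) if $s_m\le0$, stop and return $z^*=z_{m-1}^*$; (6) otherwise $\mathbb Q\leftarrow\mathbb Q\cup\{q_m\}$ and continue. Convergence assumptions (T): the GSIP satisfies (a)–(c), (E) is feasible, and every subproblem $(\mathrm M_{\mathbb Q})$ and $(\mathrm S_i(z))$ is solved to optimality. "Solved to optimality by the Algorithm" is meant in this sense: the Algorithm either terminates with a solution of (E) or generates a sequence of master solutions whose accumulation points are all optimal for (E). Density qualification (Q): with $p$ the unique root of $r(z,(p,q))=0$, the set $\{q\in\bar{\mathcal Q}:h(z,(p,q))>0\}$ is dense in $\{q\in\bar{\mathcal Q}:h(z,(p,q))\ge0\}$, for every $z\in\mathcal Z$. *)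

theory Defs
  imports "HOL-Analysis.Analysis" "HOL-Library.Extended_Nat"
begin

text \<open>
  Conventions. Euclidean spaces are types of class \<open>euclidean_space\<close>. A vector-valued constraint
  map is given by its real components, numbered from 0, together with their number (which may
  be 0). A partition of a vector \<open>v\<close> into two blocks of coordinates is a set \<open>P\<close> of standard basis
  vectors: the first block lives in \<open>span P\<close>, the second in \<open>span (Basis - P)\<close>, and the pair is the
  sum of the two blocks. This also covers empty blocks, which a product type would not.
  All maps are only looked at on their stated domains.
\<close>


section \<open>Smoothness\<close>

text \<open>
  Derivatives are taken relative to the domain, which need not be open; at an interior point this
  is the ordinary Frechet derivative. Differentiating \<open>x \<mapsto> D x\<close> again is done by
  differentiating \<open>x \<mapsto> D x v\<close> for every direction \<open>v\<close>, which is equivalent in finite dimension.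
  The highest derivative is not required to be continuous.
\<close>

primrec times_diff_on ::
  "nat \<Rightarrow> ('a::euclidean_space \<Rightarrow> real) \<Rightarrow> 'a set \<Rightarrow> bool" where
  "times_diff_on 0 f S \<longleftrightarrow> True"
| "times_diff_on (Suc k) f S \<longleftrightarrow>
     (\<exists>D. (\<forall>x\<in>S. (f has_derivative D x) (at x within S)) \<and>
          (\<forall>v. times_diff_on k (\<lambda>x. D x v) S))"

definition C_class_on ::
  "enat \<Rightarrow> ('a::euclidean_space \<Rightarrow> real) \<Rightarrow> 'a set \<Rightarrow> bool" where
  "C_class_on \<rho> f S \<longleftrightarrow>
     continuous_on S f \<and> (\<forall>k. enat k \<le> \<rho> \<longrightarrow> times_diff_on k f S)"


section \<open>Generalized semi-infinite programs\<close>

record ('z, 'v) gsip =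
  Zset :: "'z set"
  Vbar :: "'v set"
  n_g :: nat
  n_h :: nat
  n_r :: nat
  obj :: "'z \<Rightarrow> real"
  gcon :: "nat \<Rightarrow> 'z \<times> 'v \<Rightarrow> real"
  hcon :: "nat \<Rightarrow> 'z \<times> 'v \<Rightarrow> real"
  rcon :: "nat \<Rightarrow> 'z \<times> 'v \<Rightarrow> real"
  pcoord :: "'v set"  \<comment> \<open>coordinates forming the block \<open>p\<close> of \<open>v = (p,q)\<close>\<close>
  Qbar :: "'v set"    \<comment> \<open>a subset of \<open>span (Basis - pcoord)\<close>\<close>

definition gsip_V :: "('z, 'v) gsip \<Rightarrow> 'z \<Rightarrow> 'v set" where
  "gsip_V G z = {v \<in> Vbar G. (\<forall>j<n_h G. hcon G j (z, v) \<ge> 0) \<and>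
                             (\<forall>k<n_r G. rcon G k (z, v) = 0)}"

definition gsip_feasible :: "('z, 'v) gsip \<Rightarrow> 'z \<Rightarrow> bool" where
  "gsip_feasible G z \<longleftrightarrow>
     z \<in> Zset G \<and> (\<forall>v\<in>gsip_V G z. \<forall>i<n_g G. gcon G i (z, v) \<le> 0)"

definition gsip_solution :: "('z, 'v) gsip \<Rightarrow> 'z \<Rightarrow> bool" where
  "gsip_solution G z \<longleftrightarrow>
     gsip_feasible G z \<and> (\<forall>z'. gsip_feasible G z' \<longrightarrow> obj G z \<le> obj G z')"

text \<open>\<open>p\<close> solves \<open>r(z,(p,q)) = 0\<close>; membership in \<open>Vbar\<close> is the domain of \<open>r\<close>.\<close>

definition is_root ::
  "('z, 'v::euclidean_space) gsip \<Rightarrow> 'z \<Rightarrow> 'v \<Rightarrow> 'v \<Rightarrow> bool" where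
  "is_root G z p q \<longleftrightarrow>
     p \<in> span (pcoord G) \<and> p + q \<in> Vbar G \<and> (\<forall>k<n_r G. rcon G k (z, p + q) = 0)"

definition gsip_compactness ::
  "('z::euclidean_space, 'v::euclidean_space) gsip \<Rightarrow> bool" where
  "gsip_compactness G \<longleftrightarrow>
     Zset G \<noteq> {} \<and> compact (Zset G) \<and>
     (\<forall>z\<in>Zset G. gsip_V G z \<noteq> {} \<and> compact (gsip_V G z)) \<and>
     (\<exists>M. \<forall>z\<in>Zset G. norm z \<le> M \<and> (\<forall>v\<in>gsip_V G z. norm v \<le> M))"

definition gsip_partition ::
  "('z::euclidean_space, 'v::euclidean_space) gsip \<Rightarrow> bool" where
  "gsip_partition G \<longleftrightarrow>
     pcoord G \<subseteq> Basis \<and> card (pcoord G) = n_r G \<and>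
     Qbar G \<subseteq> span (Basis - pcoord G) \<and> compact (Qbar G) \<and>
     (\<exists>root. continuous_on (Zset G \<times> Qbar G) root \<and>
        (\<forall>z\<in>Zset G. \<forall>q\<in>Qbar G. \<forall>p. is_root G z p q \<longleftrightarrow> p = root (z, q))) \<and>
     (\<forall>z\<in>Zset G. \<forall>p\<in>span (pcoord G). \<forall>q\<in>span (Basis - pcoord G).
        p + q \<in> gsip_V G z \<longrightarrow> q \<in> Qbar G) \<and>
     (\<forall>z\<in>Zset G. \<forall>q\<in>Qbar G. \<forall>p. is_root G z p q \<longrightarrow> p + q \<in> interior (Vbar G))"

definition gsip_smooth ::
  "enat \<Rightarrow> ('z::euclidean_space, 'v::euclidean_space) gsip \<Rightarrow> bool" where
  "gsip_smooth \<rho> G \<longleftrightarrow>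
     C_class_on \<rho> (obj G) (Zset G) \<and>
     (\<forall>i<n_g G. C_class_on \<rho> (gcon G i) (Zset G \<times> Vbar G)) \<and>
     (\<forall>j<n_h G. C_class_on \<rho> (hcon G j) (Zset G \<times> Vbar G)) \<and>
     (\<forall>k<n_r G. C_class_on \<rho> (rcon G k) (Zset G \<times> Vbar G))"

text \<open>Boundedness of \<open>Vbar\<close> is part of the definition of a GSIP.\<close>

definition gsip_assms ::
  "enat \<Rightarrow> ('z::euclidean_space, 'v::euclidean_space) gsip \<Rightarrow> bool" where
  "gsip_assms \<rho> G \<longleftrightarrow>
     bounded (Vbar G) \<and> gsip_compactness G \<and> gsip_partition G \<and> gsip_smooth \<rho> G"

definition density_qualification :: "('z, 'v::euclidean_space) gsip \<Rightarrow> bool" where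
  "density_qualification G \<longleftrightarrow>
     (\<forall>z\<in>Zset G.
        {q \<in> Qbar G. \<exists>p. is_root G z p q \<and> (\<forall>j<n_h G. hcon G j (z, p + q) \<ge> 0)}
        \<subseteq> closure
        {q \<in> Qbar G. \<exists>p. is_root G z p q \<and> (\<forall>j<n_h G. hcon G j (z, p + q) > 0)})"


section \<open>Existence-constrained program, subproblems and algorithm\<close>

text \<open>The unit simplex in \<open>n\<close> coordinates; values at indices from \<open>n\<close> on are irrelevant.\<close>

definition simplex_weights :: "nat \<Rightarrow> (nat \<Rightarrow> real) set" where
  "simplex_weights n = {l. (\<Sum>j<n. l j) = 1 \<and> (\<forall>j<n. l j \<ge> 0)}"

definition weighted_con ::
  "('z, 'v) gsip \<Rightarrow> nat \<Rightarrow> (nat \<Rightarrow> real) \<Rightarrow> 'z \<Rightarrow> 'v \<Rightarrow> real" where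
  "weighted_con G i l z v =
     l 0 * gcon G i (z, v) + (\<Sum>j<n_h G. l (Suc j) * hcon G j (z, v))"

definition ecp_feasible :: "('z, 'v::euclidean_space) gsip \<Rightarrow> 'z \<Rightarrow> bool" where
  "ecp_feasible G z \<longleftrightarrow>
     z \<in> Zset G \<and>
     (\<forall>q\<in>Qbar G. \<forall>p. is_root G z p q \<longrightarrow>
        (\<forall>i<n_g G. \<exists>l\<in>simplex_weights (n_h G + 1). weighted_con G i l z (p + q) \<le> 0))"

definition ecp_solution :: "('z, 'v::euclidean_space) gsip \<Rightarrow> 'z \<Rightarrow> bool" where
  "ecp_solution G z \<longleftrightarrow>
     ecp_feasible G z \<and> (\<forall>z'. ecp_feasible G z' \<longrightarrow> obj G z \<le> obj G z')"

text \<open>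
  The variables \<open>p\<^sub>m\<close> and \<open>\<lambda>\<^sub>i\<^sub>,\<^sub>m\<close> of the master problem are indexed by the points \<open>q\<^sub>m\<close>
  themselves.
\<close>

definition master_feasible ::
  "('z, 'v::euclidean_space) gsip \<Rightarrow> 'v set \<Rightarrow> 'z \<Rightarrow> ('v \<Rightarrow> 'v)
     \<Rightarrow> (nat \<Rightarrow> 'v \<Rightarrow> nat \<Rightarrow> real) \<Rightarrow> bool" where
  "master_feasible G Q z p l \<longleftrightarrow>
     z \<in> Zset G \<and>
     (\<forall>q\<in>Q. is_root G z (p q) q \<and>
        (\<forall>i<n_g G. l i q \<in> simplex_weights (n_h G + 1) \<and>
                    weighted_con G i (l i q) z (p q + q) \<le> 0))"

definition master_solution ::
  "('z, 'v::euclidean_space) gsip \<Rightarrow> 'v set \<Rightarrow> 'z \<Rightarrow> ('v \<Rightarrow> 'v)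
     \<Rightarrow> (nat \<Rightarrow> 'v \<Rightarrow> nat \<Rightarrow> real) \<Rightarrow> bool" where
  "master_solution G Q z p l \<longleftrightarrow>
     master_feasible G Q z p l \<and>
     (\<forall>z' p' l'. master_feasible G Q z' p' l' \<longrightarrow> obj G z \<le> obj G z')"

definition sep_feasible ::
  "('z, 'v::euclidean_space) gsip \<Rightarrow> 'z \<Rightarrow> nat \<Rightarrow> 'v \<Rightarrow> 'v \<Rightarrow> real \<Rightarrow> bool" where
  "sep_feasible G z i q p s \<longleftrightarrow>
     q \<in> Qbar G \<and> is_root G z p q \<and>
     s \<le> gcon G i (z, p + q) \<and> (\<forall>j<n_h G. s \<le> hcon G j (z, p + q))"

definition sep_solution ::
  "('z, 'v::euclidean_space) gsip \<Rightarrow> 'z \<Rightarrow> nat \<Rightarrow> 'v \<Rightarrow> 'v \<Rightarrow> real \<Rightarrow> bool" where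
  "sep_solution G z i q p s \<longleftrightarrow>
     sep_feasible G z i q p s \<and> (\<forall>q' p' s'. sep_feasible G z i q' p' s' \<longrightarrow> s' \<le> s)"

text \<open>
  One pass through the loop with discretization \<open>Q\<close>, up to the termination test: \<open>z\<close> is the master
  solution and \<open>(q, s)\<close> the selected separation point and value. Any choice among optimal
  solutions and among maximizing indices is allowed.
\<close>

definition alg_pass ::
  "('z, 'v::euclidean_space) gsip \<Rightarrow> 'v set \<Rightarrow> 'z \<Rightarrow> 'v \<Rightarrow> real \<Rightarrow> bool" where
  "alg_pass G Q z q s \<longleftrightarrow>
     (\<exists>p l. master_solution G Q z p l) \<and>
     (\<exists>qs ps ss istar.
        (\<forall>i<n_g G. sep_solution G z i (qs i) (ps i) (ss i)) \<and>
        istar < n_g G \<and> (\<forall>i<n_g G. ss i \<le> ss istar) \<and>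
        q = qs istar \<and> s = ss istar)"

text \<open>
  A complete run from \<open>Q0\<close> with master solutions \<open>z 0, z 1, \<dots>\<close>: \<open>N\<close> is the number of the last pass,
  or \<open>\<infinity>\<close> if the algorithm does not stop. If \<open>N\<close> is finite, \<open>z N\<close> is returned.
\<close>

definition alg_run ::
  "('z, 'v::euclidean_space) gsip \<Rightarrow> 'v set \<Rightarrow> enat \<Rightarrow> (nat \<Rightarrow> 'z) \<Rightarrow> bool" where
  "alg_run G Q0 N z \<longleftrightarrow>
     (\<exists>Q q s. Q 0 = Q0 \<and>
        (\<forall>k. enat k \<le> N \<longrightarrow> alg_pass G (Q k) (z k) (q k) (s k)) \<and>
        (\<forall>k. enat k < N \<longrightarrow> s k > 0 \<and> Q (Suc k) = insert (q k) (Q k)) \<and>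
        (\<forall>n. N = enat n \<longrightarrow> s n \<le> 0))"

definition alg_solves ::
  "('z::euclidean_space, 'v::euclidean_space) gsip \<Rightarrow> 'z set \<Rightarrow> bool" where
  "alg_solves G Sol \<longleftrightarrow>
     (\<forall>Q0. finite Q0 \<and> Q0 \<noteq> {} \<and> Q0 \<subseteq> Qbar G \<longrightarrow>
        (\<exists>N z. alg_run G Q0 N z) \<and>
        (\<forall>n z. alg_run G Q0 (enat n) z \<longrightarrow> z n \<in> Sol) \<and>
        (\<forall>z. alg_run G Q0 \<infinity> z \<longrightarrow>
           (\<forall>\<sigma> zacc. strict_mono \<sigma> \<and> (z \<circ> \<sigma>) \<longlonglongrightarrow> zacc \<longrightarrow> zacc \<in> Sol)))"

text \<open>
  That every subproblem is solved to optimality enters twice: here as solvability, and in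
  \<open>alg_pass\<close>, where the returned points are optimal solutions.
\<close>

definition convergence_assms ::
  "enat \<Rightarrow> ('z::euclidean_space, 'v::euclidean_space) gsip \<Rightarrow> bool" where
  "convergence_assms \<rho> G \<longleftrightarrow>
     gsip_assms \<rho> G \<and> (\<exists>z. ecp_feasible G z) \<and>
     (\<forall>Q. finite Q \<and> Q \<subseteq> Qbar G \<longrightarrow> (\<exists>z p l. master_solution G Q z p l)) \<and>
     (\<forall>z\<in>Zset G. \<forall>i<n_g G. \<exists>q p s. sep_solution G z i q p s)"


section \<open>Robust optimal control problems\<close>

text \<open>
  The dynamics \<open>phi\<close> has as many components as the state space has dimensions, so only
  \<open>phi C k\<close> with \<open>k < DIM('x)\<close> is used.
\<close>

record ('u, 'x, 'w) rocp =
  Uset :: "'u set"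
  Xset :: "'x set"
  Wbar :: "'w set"
  Gam :: "real set"
  n_gc :: nat
  n_hc :: nat
  n_rc :: nat
  cost :: "'u \<times> 'x \<times> 'w \<Rightarrow> real"
  gc :: "nat \<Rightarrow> 'u \<times> 'x \<times> 'w \<Rightarrow> real"
  hc :: "nat \<Rightarrow> 'u \<times> 'x \<times> 'w \<Rightarrow> real"
  rc :: "nat \<Rightarrow> 'u \<times> 'x \<times> 'w \<Rightarrow> real"
  phi :: "nat \<Rightarrow> 'u \<times> 'x \<times> 'w \<Rightarrow> real"
  pccoord :: "'w set"  \<comment> \<open>coordinates forming the block \<open>p\<^sup>c\<close> of \<open>w = (p\<^sup>c,q\<^sup>c)\<close>\<close>
  Qcbar :: "'w set"    \<comment> \<open>a subset of \<open>span (Basis - pccoord)\<close>\<close>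

definition equations ::
  "('u, 'x::euclidean_space, 'w) rocp \<Rightarrow> 'u \<Rightarrow> 'x \<Rightarrow> 'w \<Rightarrow> bool" where
  "equations C u x w \<longleftrightarrow>
     (\<forall>k<DIM('x). phi C k (u, x, w) = 0) \<and> (\<forall>k<n_rc C. rc C k (u, x, w) = 0)"

definition rocp_V ::
  "('u, 'x::euclidean_space, 'w) rocp \<Rightarrow> 'u \<Rightarrow> ('x \<times> 'w) set" where
  "rocp_V C u = {(x, w). x \<in> Xset C \<and> w \<in> Wbar C \<and> equations C u x w \<and>
                         (\<forall>j<n_hc C. hc C j (u, x, w) \<ge> 0)}"

text \<open>
  The inner maximum. It is attained when \<open>rocp_V C u\<close> is non-empty and compact and the
  cost is continuous, as is assumed below.
\<close>

definition worst_cost :: "('u, 'x::euclidean_space, 'w) rocp \<Rightarrow> 'u \<Rightarrow> real" where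
  "worst_cost C u = (SUP (x, w)\<in>rocp_V C u. cost C (u, x, w))"

definition rocp_feasible :: "('u, 'x::euclidean_space, 'w) rocp \<Rightarrow> 'u \<Rightarrow> bool" where
  "rocp_feasible C u \<longleftrightarrow>
     u \<in> Uset C \<and> (\<forall>(x, w)\<in>rocp_V C u. \<forall>i<n_gc C. gc C i (u, x, w) \<le> 0)"

definition rocp_solution :: "('u, 'x::euclidean_space, 'w) rocp \<Rightarrow> 'u \<Rightarrow> bool" where
  "rocp_solution C u \<longleftrightarrow>
     rocp_feasible C u \<and>
     (\<forall>u'. rocp_feasible C u' \<longrightarrow> worst_cost C u \<le> worst_cost C u')"

definition control_compactness ::
  "('u::euclidean_space, 'x::euclidean_space, 'w::euclidean_space) rocp \<Rightarrow> bool" where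
  "control_compactness C \<longleftrightarrow>
     Xset C \<noteq> {} \<and> compact (Xset C) \<and> Uset C \<noteq> {} \<and> compact (Uset C) \<and>
     Gam C \<noteq> {} \<and> compact (Gam C) \<and>
     (\<forall>u\<in>Uset C. rocp_V C u \<noteq> {} \<and> compact (rocp_V C u))"

definition is_control_root ::
  "('u, 'x::euclidean_space, 'w::euclidean_space) rocp \<Rightarrow> 'u \<Rightarrow> 'x \<Rightarrow> 'w \<Rightarrow> 'w \<Rightarrow> bool" where
  "is_control_root C u x pc qc \<longleftrightarrow>
     x \<in> Xset C \<and> pc \<in> span (pccoord C) \<and> pc + qc \<in> Wbar C \<and> equations C u x (pc + qc)"

definition control_partition ::
  "('u::euclidean_space, 'x::euclidean_space, 'w::euclidean_space) rocp \<Rightarrow> bool" where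
  "control_partition C \<longleftrightarrow>
     pccoord C \<subseteq> Basis \<and> card (pccoord C) = n_rc C \<and>
     Qcbar C \<subseteq> span (Basis - pccoord C) \<and> compact (Qcbar C) \<and>
     (\<forall>u\<in>Uset C. \<forall>x. \<forall>pc\<in>span (pccoord C). \<forall>qc\<in>span (Basis - pccoord C).
        (x, pc + qc) \<in> rocp_V C u \<longrightarrow> qc \<in> Qcbar C) \<and>
     (\<exists>root. continuous_on (Uset C \<times> Qcbar C) root \<and>
        (\<forall>u\<in>Uset C. \<forall>qc\<in>Qcbar C. \<forall>x pc.
           is_control_root C u x pc qc \<longleftrightarrow> (x, pc) = root (u, qc))) \<and>
     (\<forall>u\<in>Uset C. \<forall>qc\<in>Qcbar C. \<forall>x pc. is_control_root C u x pc qc \<longrightarrow>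
        (x, pc + qc) \<in> interior (Xset C \<times> Wbar C))"

definition control_smooth ::
  "enat \<Rightarrow> ('u::euclidean_space, 'x::euclidean_space, 'w::euclidean_space) rocp \<Rightarrow> bool" where
  "control_smooth \<rho> C \<longleftrightarrow>
     (let S = Uset C \<times> Xset C \<times> Wbar C in
        C_class_on \<rho> (cost C) S \<and>
        (\<forall>i<n_gc C. C_class_on \<rho> (gc C i) S) \<and>
        (\<forall>j<n_hc C. C_class_on \<rho> (hc C j) S) \<and>
        (\<forall>k<n_rc C. C_class_on \<rho> (rc C k) S) \<and>
        (\<forall>k<DIM('x). C_class_on \<rho> (phi C k) S))"

definition control_cost_range :: "('u, 'x::euclidean_space, 'w) rocp \<Rightarrow> bool" where
  "control_cost_range C \<longleftrightarrow> (\<forall>u\<in>Uset C. worst_cost C u \<in> Gam C)"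

text \<open>
  The epigraph form with \<open>z = (u, \<gamma>)\<close>, \<open>v = (x, w)\<close>, \<open>p = (x, p\<^sup>c)\<close>, \<open>q = q\<^sup>c\<close>, objective \<open>\<gamma>\<close>,
  upper-level constraints \<open>(J - \<gamma>, g\<^sup>c)\<close>, and lower-level equations \<open>(\<phi>, r\<^sup>c)\<close>.
\<close>

definition epigraph_gsip ::
  "('u::euclidean_space, 'x::euclidean_space, 'w::euclidean_space) rocp
     \<Rightarrow> ('u \<times> real, 'x \<times> 'w) gsip" where
  "epigraph_gsip C = \<lparr>
     Zset = Uset C \<times> Gam C,
     Vbar = Xset C \<times> Wbar C,
     n_g = n_gc C + 1,
     n_h = n_hc C,
     n_r = DIM('x) + n_rc C,
     obj = snd,
     gcon = (\<lambda>i ((u, \<gamma>), v). case i of 0 \<Rightarrow> cost C (u, v) - \<gamma> | Suc j \<Rightarrow> gc C j (u, v)),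
     hcon = (\<lambda>j ((u, \<gamma>), v). hc C j (u, v)),
     rcon = (\<lambda>k ((u, \<gamma>), v). if k < DIM('x) then phi C k (u, v) else rc C (k - DIM('x)) (u, v)),
     pcoord = (\<lambda>b. (b, 0)) ` Basis \<union> (\<lambda>b. (0, b)) ` pccoord C,
     Qbar = {0} \<times> Qcbar C\<rparr>"

end

(* The robust problem is put in epigraph form: with the worst-case cost bounded by an extra variable
   gamma, the maximum in the objective turns into one more semi-infinite constraint, and
   the state trajectory joins the block p that is determined by the equations.

   For the algorithm, a weighted constraint can be satisfied exactly when the minimum of g_i and all
   h_j (the separation margin) is nonpositive. If an accumulation point z of the master solutions
   violated some constraint, the separation values would stay above a positive constant along a subsequence
   converging to z. But the cut added for one member of the subsequence makes the margin at the same q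
   nonpositive at the next member, which contradicts uniform continuity of the margins. *)
theory Submission
  imports Defs
begin

section \<open>Smooth maps\<close>

text \<open>By the chain rule the derivative of the composite in a fixed direction \<open>v\<close>
  is \<open>y \<mapsto> D y (L v)\<close> composed with \<open>L\<close>, again of the given form;
  hence the induction over arbitrary \<open>f\<close>.\<close>

lemma times_diff_on_compose_linear:
  assumes "bounded_linear L" "L ` T \<subseteq> S" "times_diff_on k f S"
  shows "times_diff_on k (\<lambda>x. f (L x)) T"
  using assms(3)
proof (induction k arbitrary: f)
  case 0
  then show ?case by simp
next
  case (Suc k)
  then obtain D where D: "\<And>y. y \<in> S \<Longrightarrow> (f has_derivative D y) (at y within S)"
    and D': "\<And>v. times_diff_on k (\<lambda>y. D y v) S"
    by auto
  have "((\<lambda>x. f (L x)) has_derivative (\<lambda>v. D (L x) (L v))) (at x within T)" if "x \<in> T" for x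
    using has_derivative_in_compose[OF bounded_linear_imp_has_derivative[OF assms(1)],
        of f "D (L x)" x T]
      has_derivative_subset[OF D assms(2)] that assms(2)
    by blast
  with Suc.IH[OF D'] show ?case
    by (auto intro!: exI[of _ "\<lambda>x v. D (L x) (L v)"])
qed

lemma times_diff_on_const: "times_diff_on k (\<lambda>x. c) S"
proof (induction k arbitrary: c)
  case (Suc k)
  then show ?case by (auto intro!: exI[of _ "\<lambda>x v. 0"])
qed simp

text \<open>The derivative is \<open>f\<close> at every point, so each directional derivative is a
  constant function.\<close>

lemma times_diff_on_bounded_linear:
  assumes "bounded_linear f"
  shows "times_diff_on k f S"
  using assms
  by (cases k)
    (auto intro!: exI[of _ "\<lambda>x. f"] times_diff_on_const bounded_linear_imp_has_derivative)

lemma times_diff_on_diff: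
  assumes "times_diff_on k f S" "times_diff_on k g S"
  shows "times_diff_on k (\<lambda>x. f x - g x) S"
  using assms
proof (induction k arbitrary: f g)
  case (Suc k)
  from Suc.prems(1) obtain D where "\<And>y. y \<in> S \<Longrightarrow> (f has_derivative D y) (at y within S)"
    "\<And>v. times_diff_on k (\<lambda>y. D y v) S"
    by auto
  moreover from Suc.prems(2) obtain E where
    "\<And>y. y \<in> S \<Longrightarrow> (g has_derivative E y) (at y within S)"
    "\<And>v. times_diff_on k (\<lambda>y. E y v) S"
    by auto
  ultimately show ?case
    by (auto intro!: exI[of _ "\<lambda>x v. D x v - E x v"] has_derivative_diff Suc.IH)
qed simp

lemma C_class_on_compose_linear:
  assumes "bounded_linear L" "L ` T \<subseteq> S" "C_class_on \<rho> f S"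
  shows "C_class_on \<rho> (\<lambda>x. f (L x)) T"
  using assms times_diff_on_compose_linear[OF assms(1,2)]
    continuous_on_compose2[OF _ linear_continuous_on[OF assms(1)] assms(2)]
  unfolding C_class_on_def by blast

lemma C_class_on_bounded_linear: "bounded_linear f \<Longrightarrow> C_class_on \<rho> f S"
  unfolding C_class_on_def by (auto intro: linear_continuous_on times_diff_on_bounded_linear)

lemma C_class_on_diff:
  "C_class_on \<rho> f S \<Longrightarrow> C_class_on \<rho> g S \<Longrightarrow> C_class_on \<rho> (\<lambda>x. f x - g x) S"
  unfolding C_class_on_def by (auto intro: continuous_on_diff times_diff_on_diff)


section \<open>Coordinate blocks\<close>

lemma span_subset_Basis_iff:
  fixes P :: "'a::euclidean_space set"
  assumes "P \<subseteq> Basis"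
  shows "x \<in> span P \<longleftrightarrow> (\<forall>b\<in>Basis - P. x \<bullet> b = 0)"
  using span_substd_basis[OF assms] by auto

lemma coordinate_block_decomposition:
  fixes v :: "'a::euclidean_space"
  assumes "P \<subseteq> Basis"
  obtains p q where "p \<in> span P" "q \<in> span (Basis - P)" "v = p + q"
proof
  have fin: "finite P" using assms finite_Basis finite_subset by blast
  show "(\<Sum>b\<in>P. (v \<bullet> b) *\<^sub>R b) \<in> span P"
    by (intro span_sum span_scale span_base)
  show "(\<Sum>b\<in>Basis - P. (v \<bullet> b) *\<^sub>R b) \<in> span (Basis - P)"
    by (intro span_sum span_scale span_base)
  have "v = (\<Sum>b\<in>Basis. (v \<bullet> b) *\<^sub>R b)" by (simp add: euclidean_representation)
  also have "\<dots> = (\<Sum>b\<in>P. (v \<bullet> b) *\<^sub>R b) + (\<Sum>b\<in>Basis - P. (v \<bullet> b) *\<^sub>R b)"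
    using sum.subset_diff[OF assms finite_Basis] by (simp add: add.commute)
  finally show "v = (\<Sum>b\<in>P. (v \<bullet> b) *\<^sub>R b) + (\<Sum>b\<in>Basis - P. (v \<bullet> b) *\<^sub>R b)" .
qed


section \<open>Separation margin\<close>

text \<open>The inserted \<open>f x\<close> keeps the set non-empty for empty \<open>J\<close>, so
  the minimum also makes sense when there are no \<open>h\<close> terms.\<close>

lemma continuous_on_Min_insert:
  fixes f :: "'a::topological_space \<Rightarrow> real"
  assumes "finite J" "continuous_on S f" "\<And>j. j \<in> J \<Longrightarrow> continuous_on S (h j)"
  shows "continuous_on S (\<lambda>x. Min (insert (f x) ((\<lambda>j. h j x) ` J)))"
  using assms
proof (induction J rule: finite_induct)
  case empty
  then show ?case by simp
next
  case (insert j J)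
  have "Min (insert (f x) ((\<lambda>j. h j x) ` insert j J)) =
      min (h j x) (Min (insert (f x) ((\<lambda>j. h j x) ` J)))" for x
    using insert.hyps Min_insert[of "insert (f x) ((\<lambda>j. h j x) ` J)" "h j x"]
    by (simp add: insert_commute)
  with insert show ?case by (auto intro: continuous_on_min)
qed

text \<open>For fixed \<open>z\<close> and \<open>v\<close> this is the largest \<open>s\<close>
  that the separation subproblem admits.\<close>

definition sep_margin :: "('z, 'v) gsip \<Rightarrow> nat \<Rightarrow> 'z \<times> 'v \<Rightarrow> real" where
  "sep_margin G i y = Min (insert (gcon G i y) ((\<lambda>j. hcon G j y) ` {..<n_h G}))"

lemma le_sep_margin_iff:
  "s \<le> sep_margin G i y \<longleftrightarrow> s \<le> gcon G i y \<and> (\<forall>j<n_h G. s \<le> hcon G j y)"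
  unfolding sep_margin_def by (subst Min_ge_iff) auto

lemma sep_margin_le_iff:
  "sep_margin G i y \<le> s \<longleftrightarrow> gcon G i y \<le> s \<or> (\<exists>j<n_h G. hcon G j y \<le> s)"
  unfolding sep_margin_def by (subst Min_le_iff) auto

lemma sep_feasible_iff:
  "sep_feasible G z i q p s \<longleftrightarrow>
     q \<in> Qbar G \<and> is_root G z p q \<and> s \<le> sep_margin G i (z, p + q)"
  unfolding sep_feasible_def le_sep_margin_iff by blast

text \<open>A convex combination is at least its smallest entry; conversely, full weight on a
  nonpositive entry is admissible. This eliminates the weights from (E) and from the master
  problem.\<close>

lemma ex_weighted_con_iff:
  "(\<exists>l\<in>simplex_weights (n_h G + 1). weighted_con G i l z v \<le> 0) \<longleftrightarrow> sep_margin G i (z, v) \<le> 0"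
proof
  assume "\<exists>l\<in>simplex_weights (n_h G + 1). weighted_con G i l z v \<le> 0"
  then obtain l where sum: "(\<Sum>j<Suc (n_h G). l j) = 1"
    and nonneg: "\<And>j. j < Suc (n_h G) \<Longrightarrow> l j \<ge> 0" and le: "weighted_con G i l z v \<le> 0"
    by (auto simp: simplex_weights_def)
  define m where "m = sep_margin G i (z, v)"
  have m: "m \<le> gcon G i (z, v)" "\<And>j. j < n_h G \<Longrightarrow> m \<le> hcon G j (z, v)"
    using le_sep_margin_iff[of m G i "(z, v)"] by (auto simp: m_def)
  \<comment> \<open>As the weights sum to one, \<open>m\<close> is a combination of copies of
    itself, which is compared with the weighted constraint term by term.\<close>
  have "m = (\<Sum>j<Suc (n_h G). l j) * m" using sum by simp
  also have "\<dots> = l 0 * m + (\<Sum>j<n_h G. l (Suc j) * m)"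
    by (simp add: sum.lessThan_Suc_shift sum_distrib_right distrib_right del: sum.lessThan_Suc)
  also have "\<dots> \<le> weighted_con G i l z v"
    unfolding weighted_con_def
    by (intro add_mono sum_mono mult_left_mono) (auto intro: m nonneg)
  finally show "sep_margin G i (z, v) \<le> 0" using le m_def by simp
next
  assume "sep_margin G i (z, v) \<le> 0"
  then consider "gcon G i (z, v) \<le> 0" | k where "k < n_h G" "hcon G k (z, v) \<le> 0"
    by (auto simp: sep_margin_le_iff)
  then show "\<exists>l\<in>simplex_weights (n_h G + 1). weighted_con G i l z v \<le> 0"
  proof cases
    case 1
    then show ?thesis
      by (intro bexI[of _ "\<lambda>j. if j = 0 then 1 else 0"])
        (auto simp: weighted_con_def simplex_weights_def)
  next
    case (2 k)
    have "(\<Sum>j<n_h G. (if Suc j = Suc k then 1 else 0) * hcon G j (z, v))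
        = (\<Sum>j<n_h G. if j = k then hcon G j (z, v) else 0)"
      by (rule sum.cong) auto
    with 2 show ?thesis
      by (intro bexI[of _ "\<lambda>j. if j = Suc k then 1 else 0"])
        (auto simp: weighted_con_def simplex_weights_def simp del: sum.lessThan_Suc)
  qed
qed

lemma ecp_feasible_iff:
  "ecp_feasible G z \<longleftrightarrow>
     z \<in> Zset G \<and>
     (\<forall>q\<in>Qbar G. \<forall>p. is_root G z p q \<longrightarrow> (\<forall>i<n_g G. sep_margin G i (z, p + q) \<le> 0))"
  unfolding ecp_feasible_def ex_weighted_con_iff ..

lemma master_feasibleD:
  assumes "master_feasible G Q z p l" "q \<in> Q"
  shows "is_root G z (p q) q" "i < n_g G \<Longrightarrow> sep_margin G i (z, p q + q) \<le> 0"
  using assms unfolding master_feasible_def ex_weighted_con_iff[symmetric] by blast+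

section \<open>Continuity along the lower-level root\<close>

lemma gsip_partition_root:
  assumes "gsip_partition G"
  obtains root where "continuous_on (Zset G \<times> Qbar G) root"
    "\<And>z q p. z \<in> Zset G \<Longrightarrow> q \<in> Qbar G \<Longrightarrow> is_root G z p q \<longleftrightarrow> p = root (z, q)"
  using assms unfolding gsip_partition_def by auto

text \<open>\<open>is_root\<close> includes membership in \<open>Vbar G\<close>, so substituting the
  root stays inside the domain on which \<open>f\<close> is continuous.\<close>

lemma continuous_on_at_root:
  fixes G :: "('z::euclidean_space, 'v::euclidean_space) gsip" and root :: "'z \<times> 'v \<Rightarrow> 'v"
  assumes "continuous_on (Zset G \<times> Qbar G) root"
    and "\<And>z q p. z \<in> Zset G \<Longrightarrow> q \<in> Qbar G \<Longrightarrow> is_root G z p q \<longleftrightarrow> p = root (z, q)"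
    and "continuous_on (Zset G \<times> Vbar G) (f :: _ \<Rightarrow> real)"
  shows "continuous_on (Zset G \<times> Qbar G) (\<lambda>y. f (fst y, root y + snd y))"
proof (rule continuous_on_compose2[OF assms(3)])
  show "continuous_on (Zset G \<times> Qbar G) (\<lambda>y. (fst y, root y + snd y))"
    by (intro continuous_intros assms(1))
  show "(\<lambda>y. (fst y, root y + snd y)) ` (Zset G \<times> Qbar G) \<subseteq> Zset G \<times> Vbar G"
  proof safe
    fix z q assume "z \<in> Zset G" "q \<in> Qbar G"
    then show "root (z, q) + snd (z, q) \<in> Vbar G"
      using assms(2)[of z q "root (z, q)"] by (simp add: is_root_def)
  qed simp
qed

lemma continuous_on_sep_margin:
  assumes "gsip_smooth \<rho> G" "i < n_g G"
  shows "continuous_on (Zset G \<times> Vbar G) (sep_margin G i)"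
  unfolding sep_margin_def[abs_def] using assms
  by (intro continuous_on_Min_insert) (auto simp: gsip_smooth_def C_class_on_def)


section \<open>Convergence of the algorithm\<close>

text \<open>The master problem keeps from (E) only the constraints at points of \<open>Q\<close>;
  the unique roots and the weights provided by (E) complete \<open>z\<close> to a feasible
  point.\<close>

lemma ecp_feasible_imp_master_feasible:
  assumes "gsip_partition G" "ecp_feasible G z" "Q \<subseteq> Qbar G"
  shows "\<exists>p l. master_feasible G Q z p l"
proof -
  obtain root where
    root: "\<And>z q p. z \<in> Zset G \<Longrightarrow> q \<in> Qbar G \<Longrightarrow> is_root G z p q \<longleftrightarrow> p = root (z, q)"
    using gsip_partition_root[OF assms(1)] by metis
  have z: "z \<in> Zset G" using assms(2) by (simp add: ecp_feasible_def)
  have "\<forall>i q. \<exists>l. i < n_g G \<longrightarrow> q \<in> Q \<longrightarrow>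
      l \<in> simplex_weights (n_h G + 1) \<and> weighted_con G i l z (root (z, q) + q) \<le> 0"
    using assms(2,3) root[OF z] unfolding ecp_feasible_def by blast
  then obtain l where "\<forall>i q. i < n_g G \<longrightarrow> q \<in> Q \<longrightarrow>
      l i q \<in> simplex_weights (n_h G + 1) \<and> weighted_con G i (l i q) z (root (z, q) + q) \<le> 0"
    by metis
  then have "master_feasible G Q z (\<lambda>q. root (z, q)) l"
    using z root[OF z] assms(3) unfolding master_feasible_def by auto
  then show ?thesis by blast
qed

text \<open>As the master problem relaxes (E), its optimal value is a lower bound for (E).\<close>

lemma alg_pass_obj_le:
  assumes "gsip_partition G" "alg_pass G Q z q s" "Q \<subseteq> Qbar G" "ecp_feasible G z'"
  shows "obj G z \<le> obj G z'"
  using assms(2) ecp_feasible_imp_master_feasible[OF assms(1,4,3)]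
  unfolding alg_pass_def master_solution_def by blast

lemma alg_pass_in_Zset: "alg_pass G Q z q s \<Longrightarrow> z \<in> Zset G"
  unfolding alg_pass_def master_solution_def master_feasible_def by blast

text \<open>Bounds \<open>s\<close> from above by a margin at the selected point itself;
  \<open>alg_pass_sep_margin_le\<close> conversely bounds all margins by \<open>s\<close>.\<close>

lemma alg_pass_separation:
  assumes "alg_pass G Q z q s"
  obtains i p where "i < n_g G" "q \<in> Qbar G" "is_root G z p q" "s \<le> sep_margin G i (z, p + q)"
  using assms unfolding alg_pass_def sep_solution_def sep_feasible_iff by metis

lemma alg_pass_in_Qbar: "alg_pass G Q z q s \<Longrightarrow> q \<in> Qbar G"
  by (erule alg_pass_separation)

text \<open>The margin at \<open>q'\<close> is a feasible separation value, hence at most the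
  optimum for \<open>i\<close>, which is at most the largest optimum \<open>s\<close>.\<close>

lemma alg_pass_sep_margin_le:
  assumes "alg_pass G Q z q s" "i < n_g G" "q' \<in> Qbar G" "is_root G z p' q'"
  shows "sep_margin G i (z, p' + q') \<le> s"
proof -
  obtain ss qs ps where "sep_solution G z i (qs i) (ps i) (ss i)" "ss i \<le> s"
    using assms(1,2) unfolding alg_pass_def by blast
  moreover have "sep_feasible G z i q' p' (sep_margin G i (z, p' + q'))"
    using assms(3,4) by (simp add: sep_feasible_iff)
  ultimately show ?thesis unfolding sep_solution_def by force
qed

text \<open>With \<open>s \<le> 0\<close> all margins at \<open>z\<close> are nonpositive, so
  \<open>z\<close> is feasible for (E), and the relaxation bound makes it optimal.\<close>

lemma alg_pass_stop:
  assumes "gsip_partition G" "alg_pass G Q z q s" "Q \<subseteq> Qbar G" "s \<le> 0"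
  shows "ecp_solution G z"
  unfolding ecp_solution_def ecp_feasible_iff[of G z]
  using alg_pass_obj_le[OF assms(1-3)] alg_pass_in_Zset[OF assms(2)]
    alg_pass_sep_margin_le[OF assms(2)] assms(4)
  by force

section \<open>Existence of runs\<close>

lemma alg_pass_ex:
  assumes "convergence_assms \<rho> G" "n_g G > 0" "finite Q" "Q \<subseteq> Qbar G"
  shows "\<exists>z q s. alg_pass G Q z q s"
proof -
  have "\<exists>z p l. master_solution G Q z p l"
    using assms(1,3,4) by (simp add: convergence_assms_def)
  then obtain z p l where ms: "master_solution G Q z p l" by blast
  then have z: "z \<in> Zset G" by (auto simp: master_solution_def master_feasible_def)
  have "\<forall>i<n_g G. \<exists>q p s. sep_solution G z i q p s"
    using assms(1) z by (simp add: convergence_assms_def)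
  then obtain qs ps ss where sep: "\<forall>i<n_g G. sep_solution G z i (qs i) (ps i) (ss i)"
    by metis
  \<comment> \<open>A maximizing index exists because there is at least one separation
    value.\<close>
  have "ss ` {..<n_g G} \<noteq> {}" using assms(2) by auto
  then have "Max (ss ` {..<n_g G}) \<in> ss ` {..<n_g G}" by (intro Max_in) auto
  then obtain istar where "istar < n_g G" "Max (ss ` {..<n_g G}) = ss istar" by auto
  moreover from this have "\<forall>i<n_g G. ss i \<le> ss istar"
    using Max_ge[of "ss ` {..<n_g G}"] by simp
  ultimately have "alg_pass G Q z (qs istar) (ss istar)"
    using ms sep
    unfolding alg_pass_def
    by (intro conjI exI[of _ p] exI[of _ l] exI[of _ qs] exI[of _ ps] exI[of _ ss] exI[of _ istar])
      auto
  then show ?thesis by blast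
qed

lemma alg_run_ex:
  assumes "convergence_assms \<rho> G" "n_g G > 0" "finite Q0" "Q0 \<subseteq> Qbar G"
  shows "\<exists>N z. alg_run G Q0 N z"
proof -
  have "\<forall>Q. \<exists>z q s. finite Q \<and> Q \<subseteq> Qbar G \<longrightarrow> alg_pass G Q z q s"
    using alg_pass_ex[OF assms(1,2)] by blast
  then obtain Z q s where "\<forall>Q. finite Q \<and> Q \<subseteq> Qbar G \<longrightarrow> alg_pass G Q (Z Q) (q Q) (s Q)"
    unfolding choice_iff by blast
  then have pass: "alg_pass G Q (Z Q) (q Q) (s Q)" if "finite Q" "Q \<subseteq> Qbar G" for Q
    using that by blast
  \<comment> \<open>This sequence ignores the stopping test; the run is cut off afterwards at the
    first pass with a nonpositive value, if there is one.\<close>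
  define Q where "Q = rec_nat Q0 (\<lambda>_ Q. insert (q Q) Q)"
  have Q_simps: "Q 0 = Q0" "\<And>k. Q (Suc k) = insert (q (Q k)) (Q k)" by (simp_all add: Q_def)
  have Q: "finite (Q k) \<and> Q k \<subseteq> Qbar G" for k
  proof (induction k)
    case (Suc k)
    with alg_pass_in_Qbar[OF pass, of "Q k"] show ?case by (simp add: Q_simps)
  qed (simp add: Q_simps assms)
  have run: "alg_run G Q0 N (\<lambda>k. Z (Q k))"
    if "\<forall>k. enat k < N \<longrightarrow> s (Q k) > 0" "\<forall>n. N = enat n \<longrightarrow> s (Q n) \<le> 0" for N
    unfolding alg_run_def
  proof (intro exI conjI)
    show "Q 0 = Q0" by (rule Q_simps)
    show "\<forall>k. enat k \<le> N \<longrightarrow> alg_pass G (Q k) (Z (Q k)) (q (Q k)) (s (Q k))"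
      using Q pass by blast
    show "\<forall>k. enat k < N \<longrightarrow> 0 < s (Q k) \<and> Q (Suc k) = insert (q (Q k)) (Q k)"
      using that(1) Q_simps(2) by blast
    show "\<forall>n. N = enat n \<longrightarrow> s (Q n) \<le> 0" by (rule that(2))
  qed
  show ?thesis
  proof (cases "\<exists>n. s (Q n) \<le> 0")
    case True
    then obtain n where n: "s (Q n) \<le> 0" "\<forall>k<n. \<not> s (Q k) \<le> 0"
      using exists_least_iff[of "\<lambda>n. s (Q n) \<le> 0"] by blast
    have "alg_run G Q0 (enat n) (\<lambda>k. Z (Q k))"
      by (rule run) (use n in \<open>auto simp: not_le\<close>)
    then show ?thesis by blast
  next
    case False
    then have "alg_run G Q0 \<infinity> (\<lambda>k. Z (Q k))"
      by (intro run) (auto simp: not_le)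
    then show ?thesis by blast
  qed
qed

section \<open>Sequences of passes and their limits\<close>

lemma alg_run_discretization_subset:
  assumes "Q 0 \<subseteq> Qbar G" "\<And>k. enat k \<le> N \<Longrightarrow> alg_pass G (Q k) (z k) (q k) (s k)"
    "\<And>k. enat k < N \<Longrightarrow> Q (Suc k) = insert (q k) (Q k)" "enat k \<le> N"
  shows "Q k \<subseteq> Qbar G"
  using assms(4)
proof (induction k)
  case (Suc k)
  then have k: "enat k < N" by (simp add: Suc_ile_eq)
  then have "q k \<in> Qbar G" "Q k \<subseteq> Qbar G"
    using alg_pass_in_Qbar[OF assms(2)] Suc.IH by auto
  with assms(3)[OF k] show ?case by simp
qed (use assms in simp)

lemma alg_run_accumulation_point:
  assumes ga: "gsip_assms \<rho> G" and run: "alg_run G Q0 \<infinity> z" and Q0: "Q0 \<subseteq> Qbar G"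
    and mono: "strict_mono \<sigma>" and lim: "(z \<circ> \<sigma>) \<longlonglongrightarrow> zacc"
  shows "ecp_solution G zacc"
proof -
  have part: "gsip_partition G" and smooth: "gsip_smooth \<rho> G" and cpt: "compact (Zset G)"
    using ga by (auto simp: gsip_assms_def gsip_compactness_def)
  have cptQ: "compact (Qbar G)" using part by (simp add: gsip_partition_def)
  obtain root where contr: "continuous_on (Zset G \<times> Qbar G) root"
    and root: "\<And>z q p. z \<in> Zset G \<Longrightarrow> q \<in> Qbar G \<Longrightarrow> is_root G z p q \<longleftrightarrow> p = root (z, q)"
    using gsip_partition_root[OF part] by metis
  obtain Q q s where Q_0: "Q 0 = Q0" and pass: "\<And>k. alg_pass G (Q k) (z k) (q k) (s k)"
    and spos: "\<And>k. s k > 0" and Q_Suc: "\<And>k. Q (Suc k) = insert (q k) (Q k)"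
    using run by (fastforce simp: alg_run_def)
  have Qsub: "Q k \<subseteq> Qbar G" for k
    using alg_run_discretization_subset[of Q G \<infinity> z q s k] Q_0 Q0 pass Q_Suc by auto
  have zZ: "z k \<in> Zset G" for k using alg_pass_in_Zset[OF pass] .
  have zacc: "zacc \<in> Zset G"
    using closed_sequentially[OF compact_imp_closed[OF cpt] _ lim] zZ by auto
  \<comment> \<open>The point selected in pass \<open>k\<close> is inserted on passing to
    \<open>Q (Suc k)\<close>, hence the strict inequality.\<close>
  have qmem: "q k \<in> Q m" if "k < m" for k m
    using that by (induction m) (auto simp: Q_Suc less_Suc_eq)
  have qQ: "q k \<in> Qbar G" for k using Qsub[of "Suc k"] Q_Suc by auto
  \<comment> \<open>Evaluating the margin at the root gives a function of \<open>(z, q)\<close> on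
    the compact set \<open>Zset G \<times> Qbar G\<close>.\<close>
  define F where "F i y = sep_margin G i (fst y, root y + snd y)" for i y
  have F_cont: "continuous_on (Zset G \<times> Qbar G) (F i)" if "i < n_g G" for i
    unfolding F_def
    using continuous_on_at_root[OF contr root continuous_on_sep_margin[OF smooth that]] by simp
  have F_root: "sep_margin G i (x, p + q) = F i (x, q)"
    if "x \<in> Zset G" "q \<in> Qbar G" "is_root G x p q" for i x p q
    using that root by (simp add: F_def)
  have F_le_s: "F i (z k, q') \<le> s k" if "i < n_g G" "q' \<in> Qbar G" for i k q'
    using alg_pass_sep_margin_le[OF pass that] root[OF zZ that(2)] by (simp add: F_def)
  have cut: "F i (z m, q k) \<le> 0" if im: "i < n_g G" "k < m" for i k m
  proof -
    obtain p l where "master_feasible G (Q m) (z m) p l"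
      using pass[of m] unfolding alg_pass_def master_solution_def by blast
    from master_feasibleD[OF this qmem[OF im(2)]] show ?thesis
      using F_root[OF zZ qQ] im(1) by metis
  qed
  have "F i (zacc, q') \<le> 0" if i: "i < n_g G" and q': "q' \<in> Qbar G" for i q'
  proof (rule ccontr)
    assume "\<not> F i (zacc, q') \<le> 0"
    then obtain e where e: "e > 0" "F i (zacc, q') > e" by (meson dense not_le)
    have "(\<lambda>n. F i (z (\<sigma> n), q')) \<longlonglongrightarrow> F i (zacc, q')"
      using q' zacc zZ lim
      by (intro continuous_on_tendsto_compose[OF F_cont[OF i]] tendsto_intros) (auto simp: o_def)
    then have "\<forall>\<^sub>F n in sequentially. e < F i (z (\<sigma> n), q')"
      using e(2) by (rule order_tendstoD)
    then have large: "\<forall>\<^sub>F n in sequentially. e < s (\<sigma> n)"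
      by (rule eventually_mono) (use F_le_s[OF i q'] in \<open>force intro: less_le_trans\<close>)
    have "(\<lambda>n. dist (z (\<sigma> (Suc n))) (z (\<sigma> n))) \<longlonglongrightarrow> dist zacc zacc"
      using lim LIMSEQ_Suc[OF lim] by (intro tendsto_dist) (auto simp: o_def)
    then have near: "(\<lambda>n. dist (z (\<sigma> (Suc n))) (z (\<sigma> n))) \<longlonglongrightarrow> 0" by simp
    have close: "\<forall>\<^sub>F n in sequentially. F j (z (\<sigma> n), q (\<sigma> n)) < e" if j: "j < n_g G" for j
    proof -
      \<comment> \<open>The points \<open>q (\<sigma> n)\<close> need not converge, so a radius
        \<open>d\<close> independent of them is taken from uniform continuity.\<close>
      have "uniformly_continuous_on (Zset G \<times> Qbar G) (F j)"
        using compact_uniformly_continuous[OF F_cont[OF j]] compact_Times[OF cpt cptQ] .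
      then obtain d where d: "d > 0"
        "\<And>x y. x \<in> Zset G \<times> Qbar G \<Longrightarrow> y \<in> Zset G \<times> Qbar G \<Longrightarrow> dist y x < d
           \<Longrightarrow> dist (F j y) (F j x) < e"
        using e(1) unfolding uniformly_continuous_on_def by metis
      have "\<forall>\<^sub>F n in sequentially. dist (z (\<sigma> (Suc n))) (z (\<sigma> n)) < d"
        using near d(1) by (rule order_tendstoD)
      then show ?thesis
      proof (rule eventually_mono)
        fix n assume "dist (z (\<sigma> (Suc n))) (z (\<sigma> n)) < d"
        then have "dist (F j (z (\<sigma> (Suc n)), q (\<sigma> n))) (F j (z (\<sigma> n), q (\<sigma> n))) < e"
          using zZ qQ by (intro d(2)) (auto simp: dist_prod_def)
        \<comment> \<open>The cut from pass \<open>\<sigma> n\<close> is already present in pass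
          \<open>\<sigma> (Suc n)\<close>; closeness carries the bound back to
          \<open>z (\<sigma> n)\<close> up to \<open>e\<close>.\<close>
        moreover have "F j (z (\<sigma> (Suc n)), q (\<sigma> n)) \<le> 0"
          using cut[OF j] mono by (simp add: strict_mono_Suc_iff)
        ultimately show "F j (z (\<sigma> n), q (\<sigma> n)) < e" by (simp add: dist_real_def)
      qed
    qed
    \<comment> \<open>The index selected in pass \<open>\<sigma> n\<close> may change with
      \<open>n\<close>, so the bound must hold for all of the finitely many indices at once.\<close>
    have "\<forall>\<^sub>F n in sequentially. \<forall>j\<in>{..<n_g G}. F j (z (\<sigma> n), q (\<sigma> n)) < e"
      by (rule eventually_ball_finite) (auto intro: close)
    then have "\<forall>\<^sub>F n::nat in sequentially. False"
      using large
    proof eventually_elim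
      case (elim n)
      obtain j p where "j < n_g G" "is_root G (z (\<sigma> n)) p (q (\<sigma> n))"
        "s (\<sigma> n) \<le> sep_margin G j (z (\<sigma> n), p + q (\<sigma> n))"
        using alg_pass_separation[OF pass] by metis
      with elim F_root[OF zZ qQ] show False by force
    qed
    then show False by simp
  qed
  then have "ecp_feasible G zacc"
    unfolding ecp_feasible_iff using zacc F_root[OF zacc] by metis
  \<comment> \<open>All master values are lower bounds for (E), and this passes to the
    limit.\<close>
  moreover have "obj G zacc \<le> obj G z'" if "ecp_feasible G z'" for z'
  proof (rule LIMSEQ_le_const2)
    show "(\<lambda>n. obj G (z (\<sigma> n))) \<longlonglongrightarrow> obj G zacc"
      using smooth lim zZ zacc
      by (intro continuous_on_tendsto_compose[of "Zset G" "obj G"])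
        (auto simp: gsip_smooth_def C_class_on_def o_def)
    show "\<exists>N. \<forall>n\<ge>N. obj G (z (\<sigma> n)) \<le> obj G z'"
      using alg_pass_obj_le[OF part pass Qsub that] by blast
  qed
  ultimately show ?thesis by (simp add: ecp_solution_def)
qed

theorem alg_solves_ecp:
  assumes conv: "convergence_assms \<rho> G" and "n_g G > 0"
  shows "alg_solves G {z. ecp_solution G z}"
proof -
  have ga: "gsip_assms \<rho> G" and part: "gsip_partition G"
    using conv by (auto simp: convergence_assms_def gsip_assms_def)
  have "ecp_solution G (z n)" if Q0: "Q0 \<subseteq> Qbar G" and run: "alg_run G Q0 (enat n) z" for Q0 n z
  proof -
    obtain Q q s where Q: "Q 0 = Q0"
        "\<And>k. enat k \<le> enat n \<Longrightarrow> alg_pass G (Q k) (z k) (q k) (s k)"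
        "\<And>k. enat k < enat n \<Longrightarrow> Q (Suc k) = insert (q k) (Q k)" "s n \<le> 0"
      using run unfolding alg_run_def by blast
    have "Q n \<subseteq> Qbar G"
      by (rule alg_run_discretization_subset[where N = "enat n" and Q = Q and z = z and q = q and s = s])
        (simp_all only: Q Q0 order_refl)
    with alg_pass_stop[OF part Q(2)] Q(4) show ?thesis by simp
  qed
  moreover have "\<exists>N z. alg_run G Q0 N z" if "finite Q0" "Q0 \<subseteq> Qbar G" for Q0
    using alg_run_ex[OF assms that] .
  moreover have "ecp_solution G zacc"
    if "Q0 \<subseteq> Qbar G" "alg_run G Q0 \<infinity> z" "strict_mono \<sigma>" "(z \<circ> \<sigma>) \<longlonglongrightarrow> zacc" for Q0 z \<sigma> zacc
    using alg_run_accumulation_point[OF ga that(2,1,3,4)] .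
  ultimately show ?thesis
    unfolding alg_solves_def mem_Collect_eq by (intro allI impI conjI; elim conjE)
qed


section \<open>Existence-constrained programs and density\<close>

text \<open>A negative \<open>hcon\<close> value already makes the margin nonpositive; otherwise
  \<open>p + q\<close> lies in the lower-level set, where \<open>gcon\<close> is
  nonpositive.\<close>

lemma gsip_feasible_imp_ecp_feasible:
  assumes "gsip_feasible G z"
  shows "ecp_feasible G z"
  unfolding ecp_feasible_iff
proof (intro conjI ballI allI impI)
  show "z \<in> Zset G" using assms by (simp add: gsip_feasible_def)
  fix q p i assume root: "is_root G z p q" and i: "i < n_g G"
  show "sep_margin G i (z, p + q) \<le> 0"
  proof (cases "\<forall>j<n_h G. hcon G j (z, p + q) \<ge> 0")
    case True
    with root have "p + q \<in> gsip_V G z" by (simp add: gsip_V_def is_root_def)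
    with assms i show ?thesis by (simp add: gsip_feasible_def sep_margin_le_iff)
  next
    case False
    then show ?thesis by (auto simp: sep_margin_le_iff intro: less_imp_le)
  qed
qed

text \<open>Where all \<open>hcon\<close> are strictly positive, a nonpositive margin can only come
  from \<open>gcon\<close>. Density and continuity along the root extend \<open>gcon \<le> 0\<close>
  to the points with \<open>hcon \<ge> 0\<close>.\<close>

lemma ecp_feasible_imp_gsip_feasible:
  assumes ga: "gsip_assms \<rho> G" and dens: "density_qualification G" and ecp: "ecp_feasible G z"
  shows "gsip_feasible G z"
  unfolding gsip_feasible_def
proof (intro conjI ballI allI impI)
  show z: "z \<in> Zset G" using ecp by (simp add: ecp_feasible_def)
  fix v i assume v: "v \<in> gsip_V G z" and i: "i < n_g G"
  have part: "gsip_partition G" and smooth: "gsip_smooth \<rho> G"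
    using ga by (auto simp: gsip_assms_def)
  obtain root where contr: "continuous_on (Zset G \<times> Qbar G) root"
    and root: "\<And>z q p. z \<in> Zset G \<Longrightarrow> q \<in> Qbar G \<Longrightarrow> is_root G z p q \<longleftrightarrow> p = root (z, q)"
    using gsip_partition_root[OF part] by metis
  obtain p q where pq: "p \<in> span (pcoord G)" "q \<in> span (Basis - pcoord G)" "v = p + q"
    using coordinate_block_decomposition[of "pcoord G" v] part
    by (auto simp: gsip_partition_def)
  have "\<forall>z\<in>Zset G. \<forall>p\<in>span (pcoord G). \<forall>q\<in>span (Basis - pcoord G).
      p + q \<in> gsip_V G z \<longrightarrow> q \<in> Qbar G"
    using part unfolding gsip_partition_def by (elim conjE)
  then have q: "q \<in> Qbar G" using z pq v by blast
  have pr: "is_root G z p q" using v pq by (simp add: is_root_def gsip_V_def)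
  have "q \<in> {q \<in> Qbar G. \<exists>p. is_root G z p q \<and> (\<forall>j<n_h G. hcon G j (z, p + q) \<ge> 0)}"
    using q pr v pq(3) by (auto simp: gsip_V_def)
  then have "q \<in> closure
      {q \<in> Qbar G. \<exists>p. is_root G z p q \<and> (\<forall>j<n_h G. hcon G j (z, p + q) > 0)}"
    using dens z unfolding density_qualification_def by blast
  then obtain r where r: "\<And>n. r n \<in> Qbar G"
      "\<And>n. \<exists>p. is_root G z p (r n) \<and> (\<forall>j<n_h G. hcon G j (z, p + r n) > 0)" "r \<longlonglongrightarrow> q"
    unfolding closure_sequential by auto
  have "gcon G i (z, root (z, r n) + r n) \<le> 0" for n
  proof -
    obtain p where "is_root G z p (r n)" "\<forall>j<n_h G. hcon G j (z, p + r n) > 0" using r(2) by blast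
    moreover from this have "sep_margin G i (z, p + r n) \<le> 0"
      using ecp r(1) i unfolding ecp_feasible_iff by blast
    ultimately show ?thesis using root[OF z r(1)] by (auto simp: sep_margin_le_iff)
  qed
  moreover have "continuous_on (Zset G \<times> Qbar G) (\<lambda>y. gcon G i (fst y, root y + snd y))"
    using smooth i
    by (intro continuous_on_at_root[OF contr root]) (auto simp: gsip_smooth_def C_class_on_def)
  then have "(\<lambda>n. gcon G i (fst (z, r n), root (z, r n) + snd (z, r n)))
      \<longlonglongrightarrow> gcon G i (fst (z, q), root (z, q) + snd (z, q))"
    by (rule continuous_on_tendsto_compose) (auto intro!: tendsto_intros r simp: z q r)
  ultimately have "gcon G i (z, root (z, q) + q) \<le> 0"
    by (auto intro: LIMSEQ_le_const2)
  then show "gcon G i (z, v) \<le> 0" using root[OF z q] pr pq(3) by simp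
qed

lemma ecp_feasible_iff_gsip_feasible:
  assumes "gsip_assms \<rho> G" "density_qualification G"
  shows "ecp_feasible G z \<longleftrightarrow> gsip_feasible G z"
  by (rule iffI[OF ecp_feasible_imp_gsip_feasible[OF assms] gsip_feasible_imp_ecp_feasible])


section \<open>The epigraph program\<close>

lemma epigraph_gsip_simps [simp]:
  fixes C :: "('u::euclidean_space, 'x::euclidean_space, 'w::euclidean_space) rocp"
  shows "Zset (epigraph_gsip C) = Uset C \<times> Gam C"
    "Vbar (epigraph_gsip C) = Xset C \<times> Wbar C"
    "n_g (epigraph_gsip C) = Suc (n_gc C)"
    "n_h (epigraph_gsip C) = n_hc C"
    "n_r (epigraph_gsip C) = DIM('x) + n_rc C"
    "obj (epigraph_gsip C) = snd"
    "gcon (epigraph_gsip C) 0 ((u, \<gamma>), v) = cost C (u, v) - \<gamma>"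
    "gcon (epigraph_gsip C) (Suc i) ((u, \<gamma>), v) = gc C i (u, v)"
    "hcon (epigraph_gsip C) j ((u, \<gamma>), v) = hc C j (u, v)"
    "pcoord (epigraph_gsip C) = (\<lambda>b. (b, 0)) ` Basis \<union> (\<lambda>b. (0, b)) ` pccoord C"
    "Qbar (epigraph_gsip C) = {0} \<times> Qcbar C"
  by (simp_all add: epigraph_gsip_def)

text \<open>Equation numbers below \<open>DIM('x)\<close> belong to \<open>phi\<close>, the
  remaining ones to \<open>rc\<close>, shifted by \<open>DIM('x)\<close>.\<close>

lemma epigraph_equations_iff:
  fixes C :: "('u::euclidean_space, 'x::euclidean_space, 'w::euclidean_space) rocp"
  shows "(\<forall>k<DIM('x) + n_rc C. rcon (epigraph_gsip C) k ((u, \<gamma>), x, w) = 0) \<longleftrightarrow>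
    equations C u x w"
proof
  assume R: "\<forall>k<DIM('x) + n_rc C. rcon (epigraph_gsip C) k ((u, \<gamma>), x, w) = 0"
  have "phi C k (u, x, w) = 0" if "k < DIM('x)" for k
    using that R[rule_format, of k] by (simp add: epigraph_gsip_def)
  moreover have "rc C k (u, x, w) = 0" if "k < n_rc C" for k
    using that R[rule_format, of "DIM('x) + k"] by (simp add: epigraph_gsip_def)
  ultimately show "equations C u x w" by (simp add: equations_def)
qed (auto simp: equations_def epigraph_gsip_def)

lemma gsip_V_epigraph: "gsip_V (epigraph_gsip C) (u, \<gamma>) = rocp_V C u"
  using epigraph_equations_iff[of C u \<gamma>] by (auto simp: gsip_V_def rocp_V_def)

text \<open>The state lies entirely in the block \<open>p\<close>, and \<open>q\<close> is
  \<open>q\<^sup>c\<close> padded with a zero state. Spans are compared through the vanishing of the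
  complementary coordinates.\<close>

lemma span_epigraph_blocks:
  fixes C :: "('u::euclidean_space, 'x::euclidean_space, 'w::euclidean_space) rocp"
  assumes "pccoord C \<subseteq> Basis"
  shows "pcoord (epigraph_gsip C) \<subseteq> Basis"
    and "span (pcoord (epigraph_gsip C)) = UNIV \<times> span (pccoord C)"
    and "span (Basis - pcoord (epigraph_gsip C)) = {0} \<times> span (Basis - pccoord C)"
proof -
  show sub: "pcoord (epigraph_gsip C) \<subseteq> Basis"
    using assms by (auto simp: Basis_prod_def)
  \<comment> \<open>Basis vectors are nonzero, so a vector \<open>(b, 0)\<close> never coincides
    with a vector \<open>(0, b')\<close>.\<close>
  have compl: "Basis - pcoord (epigraph_gsip C) = Pair 0 ` (Basis - pccoord C)"
    by (auto simp: Basis_prod_def dest: nonzero_Basis)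
  show "span (pcoord (epigraph_gsip C)) = UNIV \<times> span (pccoord C)"
    unfolding set_eq_iff span_subset_Basis_iff[OF sub] compl
    by (auto simp: span_subset_Basis_iff[OF assms])
  show "span (Basis - pcoord (epigraph_gsip C)) = {0} \<times> span (Basis - pccoord C)"
    unfolding set_eq_iff span_subset_Basis_iff[OF Diff_subset] mem_Times_iff
      double_diff[OF sub subset_refl] double_diff[OF assms subset_refl]
    by (auto simp: ball_Un euclidean_all_zero_iff)
qed

text \<open>The zero state in \<open>q\<close> makes the sum of the blocks
  \<open>(x, pc + qc)\<close>, the point at which the control equations are evaluated.\<close>

lemma is_root_epigraph_iff:
  assumes "pccoord C \<subseteq> Basis"
  shows "is_root (epigraph_gsip C) (u, \<gamma>) (x, pc) (0, qc) \<longleftrightarrow> is_control_root C u x pc qc"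
  using epigraph_equations_iff[of C u \<gamma> x "pc + qc"]
  by (simp add: is_root_def is_control_root_def span_epigraph_blocks[OF assms]
      del: epigraph_gsip_simps(10)) auto

section \<open>Verification of the GSIP assumptions\<close>

lemma gsip_partition_epigraph:
  fixes C :: "('u::euclidean_space, 'x::euclidean_space, 'w::euclidean_space) rocp"
  assumes "control_partition C"
  shows "gsip_partition (epigraph_gsip C)"
proof -
  let ?G = "epigraph_gsip C"
  have sub: "pccoord C \<subseteq> Basis" and card: "card (pccoord C) = n_rc C"
    and Qsub: "Qcbar C \<subseteq> span (Basis - pccoord C)" and cpt: "compact (Qcbar C)"
    and mem: "\<And>u x pc qc. u \<in> Uset C \<Longrightarrow> pc \<in> span (pccoord C) \<Longrightarrow> qc \<in> span (Basis - pccoord C)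
       \<Longrightarrow> (x, pc + qc) \<in> rocp_V C u \<Longrightarrow> qc \<in> Qcbar C"
    and inter: "\<And>u x pc qc. u \<in> Uset C \<Longrightarrow> qc \<in> Qcbar C \<Longrightarrow> is_control_root C u x pc qc
       \<Longrightarrow> (x, pc + qc) \<in> interior (Xset C \<times> Wbar C)"
    using assms unfolding control_partition_def by blast+
  obtain root where contr: "continuous_on (Uset C \<times> Qcbar C) root"
    and root: "\<And>u qc x pc. u \<in> Uset C \<Longrightarrow> qc \<in> Qcbar C \<Longrightarrow>
       is_control_root C u x pc qc \<longleftrightarrow> (x, pc) = root (u, qc)"
    using assms unfolding control_partition_def by blast
  note iff = is_root_epigraph_iff[OF sub]
  \<comment> \<open>The two families of coordinates are disjoint, so their sizes
    \<open>DIM('x)\<close> and \<open>n_rc C\<close> add up.\<close>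
  have "card (pcoord ?G) = n_r ?G"
    using sub card finite_subset[OF sub]
    by (auto simp: inj_on_def card_image dest: nonzero_Basis intro!: card_Un_disjoint[THEN trans])
  moreover have "\<exists>root. continuous_on (Zset ?G \<times> Qbar ?G) root \<and>
      (\<forall>z\<in>Zset ?G. \<forall>q\<in>Qbar ?G. \<forall>p. is_root ?G z p q \<longleftrightarrow> p = root (z, q))"
  \<comment> \<open>Here \<open>y = ((u, \<gamma>), (0, qc))\<close>, and the control root is
    evaluated at \<open>(u, qc)\<close>.\<close>
  proof (intro exI[of _ "\<lambda>y. root (fst (fst y), snd (snd y))"] conjI)
    show "continuous_on (Zset ?G \<times> Qbar ?G) (\<lambda>y. root (fst (fst y), snd (snd y)))"
      by (rule continuous_on_compose2[OF contr]) (auto intro!: continuous_intros)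
  qed (auto simp: iff root)
  ultimately show ?thesis
    unfolding gsip_partition_def using Qsub cpt span_epigraph_blocks[OF sub]
    by (simp del: epigraph_gsip_simps(3,4,5,6,7,8,9,10))
      (auto simp: gsip_V_epigraph iff intro: mem inter compact_Times)
qed

text \<open>All constraint maps factor through the linear projection \<open>L\<close> that drops
  \<open>\<gamma>\<close>, except that constraint 0 also subtracts \<open>\<gamma>\<close>, which is
  linear itself.\<close>

lemma gsip_smooth_epigraph:
  fixes C :: "('u::euclidean_space, 'x::euclidean_space, 'w::euclidean_space) rocp"
  assumes "control_smooth \<rho> C"
  shows "gsip_smooth \<rho> (epigraph_gsip C)"
proof -
  let ?G = "epigraph_gsip C"
  let ?S = "Uset C \<times> Xset C \<times> Wbar C" and ?T = "Zset ?G \<times> Vbar ?G"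
  have C: "C_class_on \<rho> (cost C) ?S" "\<And>i. i < n_gc C \<Longrightarrow> C_class_on \<rho> (gc C i) ?S"
    "\<And>j. j < n_hc C \<Longrightarrow> C_class_on \<rho> (hc C j) ?S" "\<And>k. k < n_rc C \<Longrightarrow> C_class_on \<rho> (rc C k) ?S"
    "\<And>k. k < DIM('x) \<Longrightarrow> C_class_on \<rho> (phi C k) ?S"
    using assms by (simp_all add: control_smooth_def Let_def)
  define L :: "('u \<times> real) \<times> 'x \<times> 'w \<Rightarrow> 'u \<times> 'x \<times> 'w" where "L y = (fst (fst y), snd y)" for y
  have "bounded_linear L" unfolding L_def[abs_def]
    by (intro bounded_linear_intros)
  moreover have "L ` ?T \<subseteq> ?S" by (auto simp: L_def)
  ultimately have lift: "C_class_on \<rho> (\<lambda>y. f (L y)) ?T" if "C_class_on \<rho> f ?S" for f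
    using that by (rule C_class_on_compose_linear)
  have "C_class_on \<rho> (gcon ?G i) ?T" if "i < n_g ?G" for i
  proof (cases i)
    case 0
    have "C_class_on \<rho> (\<lambda>y. snd (fst y)) ?T"
      by (intro C_class_on_bounded_linear bounded_linear_intros)
    from C_class_on_diff[OF lift[OF C(1)] this]
    have "C_class_on \<rho> (\<lambda>y. cost C (L y) - snd (fst y)) ?T" .
    moreover have "gcon ?G i = (\<lambda>y. cost C (L y) - snd (fst y))" by (auto simp: 0 L_def)
    ultimately show ?thesis by simp
  next
    case (Suc k)
    have "gcon ?G i = (\<lambda>y. gc C k (L y))" by (auto simp: Suc L_def)
    with lift[OF C(2)] Suc that show ?thesis by simp
  qed
  moreover have "C_class_on \<rho> (hcon ?G j) ?T" if "j < n_h ?G" for j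
  proof -
    have "hcon ?G j = (\<lambda>y. hc C j (L y))" by (auto simp: L_def)
    with lift[OF C(3)] that show ?thesis by simp
  qed
  moreover have "C_class_on \<rho> (rcon ?G k) ?T" if "k < n_r ?G" for k
  proof (cases "k < DIM('x)")
    case True
    then have "rcon ?G k = (\<lambda>y. phi C k (L y))" by (auto simp: L_def epigraph_gsip_def)
    with lift[OF C(5)] True show ?thesis by simp
  next
    case False
    then have "rcon ?G k = (\<lambda>y. rc C (k - DIM('x)) (L y))"
      by (auto simp: L_def epigraph_gsip_def)
    with lift[OF C(4)] False that show ?thesis by simp
  qed
  moreover have "C_class_on \<rho> (obj ?G) (Zset ?G)"
    by (simp add: C_class_on_bounded_linear bounded_linear_snd)
  ultimately show ?thesis unfolding gsip_smooth_def by blast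
qed

lemma gsip_assms_epigraph:
  assumes "compact (Wbar C)" "control_compactness C" "control_partition C" "control_smooth \<rho> C"
  shows "gsip_assms \<rho> (epigraph_gsip C)"
proof -
  let ?G = "epigraph_gsip C"
  have bV: "bounded (Vbar ?G)" and cZ: "compact (Zset ?G)"
    using assms(1,2) by (auto simp: control_compactness_def intro: compact_imp_bounded compact_Times)
  obtain M1 M2 where "\<forall>v\<in>Vbar ?G. norm v \<le> M1" "\<forall>z\<in>Zset ?G. norm z \<le> M2"
    using bV compact_imp_bounded[OF cZ] unfolding bounded_iff by blast
  then have "\<forall>z\<in>Zset ?G. norm z \<le> max M1 M2 \<and> (\<forall>v\<in>gsip_V ?G z. norm v \<le> max M1 M2)"
    unfolding gsip_V_def by force
  moreover have "\<forall>z\<in>Zset ?G. gsip_V ?G z \<noteq> {} \<and> compact (gsip_V ?G z)" "Zset ?G \<noteq> {}"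
    using assms(2) by (auto simp: control_compactness_def gsip_V_epigraph)
  ultimately have "gsip_compactness ?G"
    unfolding gsip_compactness_def using cZ by blast
  with bV gsip_partition_epigraph[OF assms(3)] gsip_smooth_epigraph[OF assms(4)]
  show ?thesis by (simp add: gsip_assms_def)
qed

section \<open>Feasible points, solutions and optimal values\<close>

text \<open>A real supremum is a least upper bound only for non-empty sets bounded above;
  compactness of \<open>rocp_V C u\<close> and continuity of the cost provide the bound.\<close>

lemma worst_cost_le_iff:
  assumes "control_compactness C" "control_smooth \<rho> C" "u \<in> Uset C"
  shows "worst_cost C u \<le> \<gamma> \<longleftrightarrow> (\<forall>v\<in>rocp_V C u. cost C (u, v) \<le> \<gamma>)"
proof -
  have V: "rocp_V C u \<noteq> {}" "compact (rocp_V C u)"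
    using assms by (auto simp: control_compactness_def)
  have "continuous_on (Uset C \<times> Xset C \<times> Wbar C) (cost C)"
    using assms(2) by (simp add: control_smooth_def C_class_on_def Let_def)
  then have "continuous_on (rocp_V C u) (\<lambda>v. cost C (u, v))"
    by (rule continuous_on_compose2) (auto intro!: continuous_intros simp: assms rocp_V_def)
  then have "bdd_above ((\<lambda>v. cost C (u, v)) ` rocp_V C u)"
    using V(2) by (intro bounded_imp_bdd_above compact_imp_bounded compact_continuous_image)
  moreover have "worst_cost C u = (SUP v\<in>rocp_V C u. cost C (u, v))"
    unfolding worst_cost_def by (intro arg_cong[where f = Sup] image_cong) auto
  ultimately show ?thesis using V(1) by (simp add: cSUP_le_iff)
qed

text \<open>Constraint 0 keeps the cost below \<open>\<gamma>\<close> on the whole uncertainty set;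
  the other constraints are those of (R).\<close>

lemma gsip_feasible_epigraph_iff:
  assumes "control_compactness C" "control_smooth \<rho> C"
  shows "gsip_feasible (epigraph_gsip C) (u, \<gamma>) \<longleftrightarrow>
    rocp_feasible C u \<and> \<gamma> \<in> Gam C \<and> worst_cost C u \<le> \<gamma>"
proof (cases "u \<in> Uset C")
  case True
  show ?thesis
    unfolding gsip_feasible_def rocp_feasible_def worst_cost_le_iff[OF assms True]
    by (auto simp: gsip_V_epigraph All_less_Suc2)
qed (simp add: gsip_feasible_def rocp_feasible_def)

text \<open>By the cost range assumption every feasible \<open>u'\<close> yields the feasible pair
  \<open>(u', worst_cost C u')\<close>. So an optimal \<open>\<gamma>\<close> is at most every
  worst-case cost, including that of \<open>u\<close>, which forces equality.\<close>

lemma gsip_solution_epigraph_iff: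
  assumes "control_compactness C" "control_smooth \<rho> C" "control_cost_range C"
  shows "gsip_solution (epigraph_gsip C) (u, \<gamma>) \<longleftrightarrow> rocp_solution C u \<and> \<gamma> = worst_cost C u"
proof -
  have Gam: "worst_cost C u \<in> Gam C" if "rocp_feasible C u" for u
    using that assms(3) by (simp add: rocp_feasible_def control_cost_range_def)
  note iff = gsip_feasible_epigraph_iff[OF assms(1,2)]
  show ?thesis
  proof
    assume sol: "gsip_solution (epigraph_gsip C) (u, \<gamma>)"
    then have u: "rocp_feasible C u" and le: "worst_cost C u \<le> \<gamma>"
      by (simp_all add: gsip_solution_def iff)
    have "\<gamma> \<le> worst_cost C u'" if "rocp_feasible C u'" for u'
    proof -
      have "gsip_feasible (epigraph_gsip C) (u', worst_cost C u')"
        using that Gam by (simp add: iff)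
      with sol show ?thesis by (fastforce simp: gsip_solution_def)
    qed
    with u le show "rocp_solution C u \<and> \<gamma> = worst_cost C u"
      unfolding rocp_solution_def by (blast intro: antisym order.trans)
  next
    assume sol: "rocp_solution C u \<and> \<gamma> = worst_cost C u"
    have "\<gamma> \<le> \<gamma>'" if "gsip_feasible (epigraph_gsip C) (u', \<gamma>')" for u' \<gamma>'
      using that sol unfolding iff rocp_solution_def by (blast intro: order.trans)
    moreover have "gsip_feasible (epigraph_gsip C) (u, \<gamma>)"
      using sol Gam by (simp add: iff rocp_solution_def)
    ultimately show "gsip_solution (epigraph_gsip C) (u, \<gamma>)"
      by (simp add: gsip_solution_def)
  qed
qed

text \<open>Infima are compared without assuming attainment; both families of values lie in the
  compact set \<open>Gam C\<close> and are thus bounded below.\<close>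

lemma epigraph_optimal_value:
  assumes "control_compactness C" "control_smooth \<rho> C" "control_cost_range C"
  shows "(INF z\<in>{z. gsip_feasible (epigraph_gsip C) z}. obj (epigraph_gsip C) z) =
    (INF u\<in>{u. rocp_feasible C u}. worst_cost C u)"
proof (cases "\<exists>u. rocp_feasible C u")
  case False
  then have "{z. gsip_feasible (epigraph_gsip C) z} = {}" "{u. rocp_feasible C u} = {}"
    using gsip_feasible_epigraph_iff[OF assms(1,2)] by auto
  \<comment> \<open>For infeasible problems both sides are the same default value, the real infimum
    of the empty set.\<close>
  then show ?thesis by (simp only: image_empty)
next
  case True
  let ?A = "{z. gsip_feasible (epigraph_gsip C) z}" and ?B = "{u. rocp_feasible C u}"
  have Gam: "worst_cost C u \<in> Gam C" if "rocp_feasible C u" for u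
    using that assms(3) by (simp add: rocp_feasible_def control_cost_range_def)
  note iff = gsip_feasible_epigraph_iff[OF assms(1,2)]
  have "compact (Gam C)" using assms(1) by (simp add: control_compactness_def)
  then have bddG: "bdd_below (Gam C)" by (intro bounded_imp_bdd_below compact_imp_bounded)
  have bdd: "bdd_below (snd ` ?A)" "bdd_below (worst_cost C ` ?B)"
    by (rule bdd_below_mono[OF bddG]; auto simp: iff Gam)+
  obtain u where "rocp_feasible C u" using True by blast
  then have "u \<in> ?B" "(u, worst_cost C u) \<in> ?A" using iff Gam by auto
  then have ne: "?B \<noteq> {}" "?A \<noteq> {}" by blast+
  have "(INF z\<in>?A. snd z) = (INF u\<in>?B. worst_cost C u)"
  proof (rule antisym)
    show "(INF z\<in>?A. snd z) \<le> (INF u\<in>?B. worst_cost C u)"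
    proof (rule cINF_greatest[OF ne(1)])
      fix u assume "u \<in> ?B"
      then have "(u, worst_cost C u) \<in> ?A" using Gam by (simp add: iff)
      from cINF_lower[OF bdd(1) this] show "(INF z\<in>?A. snd z) \<le> worst_cost C u" by simp
    qed
    show "(INF u\<in>?B. worst_cost C u) \<le> (INF z\<in>?A. snd z)"
    proof (rule cINF_greatest[OF ne(2)])
      fix z assume "z \<in> ?A"
      then have "fst z \<in> ?B" "worst_cost C (fst z) \<le> snd z" by (cases z; simp add: iff)+
      with cINF_lower[OF bdd(2)] show "(INF u\<in>?B. worst_cost C u) \<le> snd z"
        by (blast intro: order.trans)
    qed
  qed
  then show ?thesis by simp
qed

theorem theorem3:
  fixes C :: "('u::euclidean_space, 'x::euclidean_space, 'w::euclidean_space) rocp"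
    and \<rho> :: enat
  assumes "compact (Wbar C)"
    and "control_compactness C"
    and "control_partition C"
    and "control_smooth \<rho> C"
    and "control_cost_range C"
  shows
    \<comment> \<open>conjuncts: (R) is a GSIP of the same smoothness; the algorithm solves the
      existence-constrained program; under the density qualification this amounts to solving (R)\<close>
    "(gsip_assms \<rho> (epigraph_gsip C) \<and>
      (\<forall>u \<gamma>. gsip_feasible (epigraph_gsip C) (u, \<gamma>) \<longleftrightarrow>
         rocp_feasible C u \<and> \<gamma> \<in> Gam C \<and> worst_cost C u \<le> \<gamma>) \<and>
      (\<forall>u \<gamma>. gsip_solution (epigraph_gsip C) (u, \<gamma>) \<longleftrightarrow>
         rocp_solution C u \<and> \<gamma> = worst_cost C u) \<and>
      (INF z\<in>{z. gsip_feasible (epigraph_gsip C) z}. obj (epigraph_gsip C) z) =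
         (INF u\<in>{u. rocp_feasible C u}. worst_cost C u))
     \<and>
     (convergence_assms \<rho> (epigraph_gsip C) \<longrightarrow>
        alg_solves (epigraph_gsip C) {z. ecp_solution (epigraph_gsip C) z})
     \<and>
     (convergence_assms \<rho> (epigraph_gsip C) \<and> density_qualification (epigraph_gsip C) \<longrightarrow>
        (\<forall>z. ecp_feasible (epigraph_gsip C) z \<longleftrightarrow> gsip_feasible (epigraph_gsip C) z) \<and>
        (\<forall>u \<gamma>. ecp_solution (epigraph_gsip C) (u, \<gamma>) \<longleftrightarrow>
           rocp_solution C u \<and> \<gamma> = worst_cost C u) \<and>
        alg_solves (epigraph_gsip C) {(u, \<gamma>). rocp_solution C u \<and> \<gamma> = worst_cost C u})"
proof -
  let ?G = "epigraph_gsip C"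
  have ga: "gsip_assms \<rho> ?G" using gsip_assms_epigraph[OF assms(1-4)] .
  \<comment> \<open>The cost constraint guarantees at least one upper-level constraint, as the
    selection of an index requires.\<close>
  have solves: "alg_solves ?G {z. ecp_solution ?G z}" if "convergence_assms \<rho> ?G"
    using alg_solves_ecp[OF that] by simp
  have ecp: "ecp_feasible ?G z \<longleftrightarrow> gsip_feasible ?G z" if "density_qualification ?G" for z
    using ecp_feasible_iff_gsip_feasible[OF ga that] .
  note sol = gsip_solution_epigraph_iff[OF assms(2,4,5)]
  have ecp_sol: "ecp_solution ?G (u, \<gamma>) \<longleftrightarrow> rocp_solution C u \<and> \<gamma> = worst_cost C u"
    if "density_qualification ?G" for u \<gamma>
    unfolding sol[symmetric] ecp_solution_def gsip_solution_def ecp[OF that] ..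
  have "{z. ecp_solution ?G z} = {(u, \<gamma>). rocp_solution C u \<and> \<gamma> = worst_cost C u}"
    if "density_qualification ?G"
    unfolding set_eq_iff split_paired_All mem_Collect_eq prod.case using ecp_sol[OF that] by blast
  then have solves_R: "alg_solves ?G {(u, \<gamma>). rocp_solution C u \<and> \<gamma> = worst_cost C u}"
    if "convergence_assms \<rho> ?G" "density_qualification ?G"
    using solves[OF that(1)] that(2) by simp
  show ?thesis
    by (intro conjI allI impI; (elim conjE)?)
      (rule ga gsip_feasible_epigraph_iff[OF assms(2,4)] sol
        epigraph_optimal_value[OF assms(2,4,5)] solves ecp ecp_sol solves_R; assumption?)+
qed

end
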